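(* Let $g_j\in\mathbb{R}[x_1,x_2,\dots,x_l]$ for $1\le j\le n$, and let $\sigma$ be a permutation of $\{1,\dots,l\}$. There exists some constant $C=C(l)>0$ such that the inequality $$\int_{a_{\sigma(l)}}^{b_{\sigma(l)}}\cdots\int_{a_{\sigma(1)}}^{b_{\sigma(1)}}\sqrt{\sum_{j=1}^{n}g_j^2}\;dx_{\sigma(1)}\cdots dx_{\sigma(l)}\;\ge\; C(l)\sqrt{\sum_{j=1}^{n}\left(\int_{a_{\sigma(l)}}^{b_{\sigma(l)}}\cdots\int_{a_{\sigma(1)}}^{b_{\sigma(1)}}g_j\,dx_{\sigma(1)}\cdots dx_{\sigma(l)}\right)^2}$$ holds for $b_i>a_i$ for each $1\le i\le l$.
   Context: Here $a_i,b_i$ are real numbers, and the variable $x_{\sigma(i)}$ is integrated over $[a_{\sigma(i)},b_{\sigma(i)}]$. *)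

theory Defs
  imports "HOL-Analysis.Analysis" "HOL-Library.Poly_Mapping" "HOL-Combinatorics.Permutations"
begin

(* A monomial is a finitely supported exponent vector; a polynomial is a finitely supported
   family of real coefficients indexed by monomials. *)
type_synonym real_mpoly = "(nat \<Rightarrow>\<^sub>0 nat) \<Rightarrow>\<^sub>0 real"

(* The polynomial ring R[x_1, ..., x_l]. *)
definition polys_upto :: "nat \<Rightarrow> real_mpoly set" where
  "polys_upto l = {p. \<forall>m \<in> Poly_Mapping.keys p. Poly_Mapping.keys m \<subseteq> {1..l}}"

definition eval_mpoly :: "real_mpoly \<Rightarrow> (nat \<Rightarrow> real) \<Rightarrow> real" where
  "eval_mpoly p x =
     (\<Sum>m \<in> Poly_Mapping.keys p.
        Poly_Mapping.lookup p m *
          (\<Prod>i \<in> Poly_Mapping.keys m. x i ^ Poly_Mapping.lookup m i))"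

(* iter_int s a b k F integrates F over the variables x_{s 1} (innermost), ..., x_{s k}
   (outermost), with x_{s i} ranging over [a (s i), b (s i)]. The result is still a function of
   the point x, since the variables other than x_{s 1}, ..., x_{s k} remain free. *)
primrec iter_int ::
  "(nat \<Rightarrow> nat) \<Rightarrow> (nat \<Rightarrow> real) \<Rightarrow> (nat \<Rightarrow> real) \<Rightarrow> nat \<Rightarrow>
     ((nat \<Rightarrow> real) \<Rightarrow> real) \<Rightarrow> (nat \<Rightarrow> real) \<Rightarrow> real" where
  "iter_int s a b 0 F = F"
| "iter_int s a b (Suc k) F =
     (\<lambda>x. integral {a (s (Suc k))..b (s (Suc k))}
            (\<lambda>t. iter_int s a b k F (x(s (Suc k) := t))))"

(* All l variables are integrated out, so the base point 0 is immaterial for integrands that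
   depend on x_1, ..., x_l only and s permuting {1..l}. *)
definition full_iter_int ::
  "nat \<Rightarrow> (nat \<Rightarrow> nat) \<Rightarrow> (nat \<Rightarrow> real) \<Rightarrow> (nat \<Rightarrow> real) \<Rightarrow>
     ((nat \<Rightarrow> real) \<Rightarrow> real) \<Rightarrow> real" where
  "full_iter_int l s a b F = iter_int s a b l F (\<lambda>_. 0)"

end

theory Submission imports Defs begin

text \<open>
  The constant \<open>C = 1\<close> works for every \<open>l\<close>: the inequality says that the Euclidean norm of the
  integral of the vector \<open>(g\<^sub>1, \<dots>, g\<^sub>n)\<close> is at most the integral of its Euclidean norm, which is
  Minkowski's integral inequality. The argument is by duality. Let \<open>I\<close> be the vector of
  integrals. The pointwise Cauchy--Schwarz inequality bounds the inner product of \<open>I\<close> with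
  \<open>g x\<close> by \<open>\<bar>I\<bar> * \<bar>g x\<bar>\<close>; integrating, by linearity and monotonicity, turns the left side into
  \<open>\<bar>I\<bar>\<^sup>2\<close>, and one factor \<open>\<bar>I\<bar>\<close> cancels.

  The remaining point is that the iterated integral is linear and monotone, since the
  library integral is additive and monotone on integrable functions only and the inner integrals
  are themselves integrands. Continuity for the product topology on \<open>nat \<Rightarrow> real\<close> settles this:
  it implies integrability in each single variable, and it is inherited by the partial
  integrals (\<open>continuous_on_iter_int\<close>).
\<close>

lemma continuous_on_fun_upd_variable:
  fixes F :: "('i \<Rightarrow> real) \<Rightarrow> real"
  assumes "continuous_on UNIV F"
  shows "continuous_on UNIV (\<lambda>p. F ((fst p)(i := snd p)))"
proof -
  have "continuous_on UNIV (\<lambda>p::('i \<Rightarrow> real) \<times> real. (fst p)(i := snd p))"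
  proof (rule continuous_on_coordinatewise_then_product)
    fix k
    show "continuous_on UNIV (\<lambda>p::('i \<Rightarrow> real) \<times> real. ((fst p)(i := snd p)) k)"
      by (cases "k = i")
        (simp_all add: continuous_on_snd continuous_on_product_then_coordinatewise continuous_on_fst)
  qed
  then show ?thesis
    by (rule continuous_on_compose2[OF assms]) auto
qed

lemma continuous_on_iter_int:
  assumes "continuous_on UNIV F"
  shows "continuous_on UNIV (iter_int s a b k F)"
proof (induction k)
  case 0
  then show ?case using assms by simp
next
  case (Suc k)
  let ?i = "s (Suc k)"
  have "continuous_on (UNIV \<times> cbox (a ?i) (b ?i)) (\<lambda>(x, t). iter_int s a b k F (x(?i := t)))"
    unfolding case_prod_unfold
    by (rule continuous_on_subset[OF continuous_on_fun_upd_variable[OF Suc.IH]]) simp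
  from integral_continuous_on_param[OF this] show ?case
    by simp
qed

lemma integrable_iter_int_slice:
  assumes "continuous_on UNIV F"
  shows "(\<lambda>t. iter_int s a b k F (x(i := t))) integrable_on {c..d}"
proof -
  have "continuous_on {c..d} (\<lambda>t. iter_int s a b k F ((fst (x, t))(i := snd (x, t))))"
    by (rule continuous_on_compose2[OF continuous_on_fun_upd_variable[OF continuous_on_iter_int[OF assms]]])
      (simp_all add: continuous_on_Pair)
  then show ?thesis
    by (intro integrable_continuous_real) simp
qed

lemma iter_int_mono:
  assumes "continuous_on UNIV F" "continuous_on UNIV G" "\<And>x. F x \<le> G x"
  shows "iter_int s a b k F x \<le> iter_int s a b k G x"
proof (induction k arbitrary: x)
  case 0
  then show ?case using assms(3) by simp
next
  case (Suc k)
  then show ?case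
    by (auto intro!: integral_le integrable_iter_int_slice assms)
qed

lemma iter_int_mult_left:
  "iter_int s a b k (\<lambda>x. c * F x) x = c * iter_int s a b k F x"
  by (induction k arbitrary: x) simp_all

lemma iter_int_sum:
  assumes "finite J" "\<And>j. j \<in> J \<Longrightarrow> continuous_on UNIV (F j)"
  shows "iter_int s a b k (\<lambda>x. \<Sum>j\<in>J. F j x) x = (\<Sum>j\<in>J. iter_int s a b k (F j) x)"
proof (induction k arbitrary: x)
  case (Suc k)
  show ?case
    unfolding iter_int.simps Suc.IH
    by (rule integral_sum) (auto intro!: assms integrable_iter_int_slice)
qed simp

text \<open>
  Minkowski's integral inequality for iterated integrals. When the norm \<open>\<bar>I\<bar>\<close> on the left
  vanishes it cannot be cancelled, and the claim is instead that the integral of a nonnegative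
  function is nonnegative.
\<close>

lemma L2_set_iter_int_le:
  assumes fin: "finite J" and cont: "\<And>j. j \<in> J \<Longrightarrow> continuous_on UNIV (F j)"
  shows "L2_set (\<lambda>j. iter_int s a b k (F j) x) J \<le> iter_int s a b k (\<lambda>x. L2_set (\<lambda>j. F j x) J) x"
proof -
  define I where "I j = iter_int s a b k (F j) x" for j
  let ?S = "L2_set I J"
  let ?N = "\<lambda>x. L2_set (\<lambda>j. F j x) J"
  have contN: "continuous_on UNIV ?N"
    unfolding L2_set_def by (intro continuous_intros cont)
  have "?S * ?S = (\<Sum>j\<in>J. I j * I j)"
    unfolding L2_set_def by (simp add: sum_nonneg flip: power2_eq_square)
  also have "\<dots> = iter_int s a b k (\<lambda>x. \<Sum>j\<in>J. I j * F j x) x"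
    by (subst iter_int_sum) (auto simp: iter_int_mult_left I_def intro!: fin cont continuous_intros)
  also have "\<dots> \<le> iter_int s a b k (\<lambda>x. ?S * ?N x) x"
  proof (rule iter_int_mono)
    fix y
    have "(\<Sum>j\<in>J. I j * F j y) \<le> (\<Sum>j\<in>J. \<bar>I j\<bar> * \<bar>F j y\<bar>)"
      by (intro sum_mono) (metis abs_ge_self abs_mult)
    also have "\<dots> \<le> ?S * ?N y"
      by (rule L2_set_mult_ineq)
    finally show "(\<Sum>j\<in>J. I j * F j y) \<le> ?S * ?N y" .
  qed (auto intro!: continuous_intros cont contN)
  also have "\<dots> = ?S * iter_int s a b k ?N x"
    by (rule iter_int_mult_left)
  finally have cancel: "?S * ?S \<le> ?S * iter_int s a b k ?N x" .
  have "?S \<le> iter_int s a b k ?N x"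
  proof (cases "?S = 0")
    case True
    have "iter_int s a b k (\<lambda>x. 0 * ?N x) x \<le> iter_int s a b k ?N x"
      by (rule iter_int_mono) (auto intro!: continuous_intros contN)
    then show ?thesis
      unfolding iter_int_mult_left using True by simp
  next
    case False
    then have "0 < ?S"
      using L2_set_nonneg[of I J] by linarith
    with cancel show ?thesis by simp
  qed
  then show ?thesis
    by (simp add: I_def[abs_def])
qed

lemma continuous_on_eval_mpoly: "continuous_on UNIV (eval_mpoly p)"
  unfolding eval_mpoly_def[abs_def]
  by (intro continuous_intros continuous_on_product_coordinates)

theorem theorem2p6:
  fixes l :: nat
  shows "\<exists>C::real. C > 0 \<and>
    (\<forall>(n::nat) (g :: nat \<Rightarrow> real_mpoly) (\<sigma> :: nat \<Rightarrow> nat) (a :: nat \<Rightarrow> real) (b :: nat \<Rightarrow> real).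
       (\<forall>j\<in>{1..n}. g j \<in> polys_upto l) \<longrightarrow>
       \<sigma> permutes {1..l} \<longrightarrow>
       (\<forall>i\<in>{1..l}. b i > a i) \<longrightarrow>
       full_iter_int l \<sigma> a b (\<lambda>x. sqrt (\<Sum>j=1..n. (eval_mpoly (g j) x)\<^sup>2))
         \<ge> C * sqrt (\<Sum>j=1..n. (full_iter_int l \<sigma> a b (eval_mpoly (g j)))\<^sup>2))"
proof (intro exI[of _ 1] conjI allI impI)
  fix n :: nat and g :: "nat \<Rightarrow> real_mpoly" and \<sigma> :: "nat \<Rightarrow> nat" and a b :: "nat \<Rightarrow> real"
  have "L2_set (\<lambda>j. full_iter_int l \<sigma> a b (eval_mpoly (g j))) {1..n}
      \<le> full_iter_int l \<sigma> a b (\<lambda>x. L2_set (\<lambda>j. eval_mpoly (g j) x) {1..n})"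
    unfolding full_iter_int_def
    by (rule L2_set_iter_int_le) (auto intro: continuous_on_eval_mpoly)
  then show "full_iter_int l \<sigma> a b (\<lambda>x. sqrt (\<Sum>j=1..n. (eval_mpoly (g j) x)\<^sup>2))
      \<ge> 1 * sqrt (\<Sum>j=1..n. (full_iter_int l \<sigma> a b (eval_mpoly (g j)))\<^sup>2)"
    by (simp add: L2_set_def)
qed simp

end
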